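(* Let $(\mathcal{F}_m)_{m\in\mathcal{M}_n}$ be any countable family of models and $(t_m)_{m\in\mathcal{M}_n}$ any sequence of positive numbers. Let $\widehat m\in\arg\min_{m\in\mathcal{M}_n}\{P_n(\widehat f_m)+\operatorname{pen}(m)\}$ and assume that some $c\in(0,1)$ exists such that $$\forall m\in\mathcal{M}_n,\qquad(1-c)\operatorname{pen}(m)\ \ge\ (P-P_n)(\widehat f_m-f_m)+\frac{t_m}{n}\ \ge\ 0$$ on an event of probability at least $1-\eta$. Then there exists an event of probability at least $1-\eta-2\sum_{m\in\mathcal{M}_n}e^{-t_m}$ on which, for every $\varepsilon\in(0,1)$, $$P(\widehat f_{\widehat m}-f^{\star})\le\frac1{1-\varepsilon}\inf_{m\in\mathcal{M}_n}\Bigl\{P(f_m-f^{\star})+\operatorname{pen}(m)+v(m)+\frac{t_m}{3n}\Bigr\}+V_n,$$ where $$V_n:=\frac1{1-\varepsilon}\sup_{m\in\mathcal{M}_n}\bigl\{v(m)-\varepsilon P(f_m-f^{\star})-c\operatorname{pen}(m)\bigr\}\qquad\text{and}\qquad v(m):=\sqrt{\frac{2t_m}{n}\operatorname{var}_P(f_m-f^{\star})}.$$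
   Context: General empirical minimization framework. $\xi_1,\dots,\xi_n$ are i.i.d. random variables with distribution $P$ on a measurable space $\Xi$; $P_n=n^{-1}\sum_{i=1}^n\delta_{\xi_i}$ is the empirical measure. $\mathcal{F}$ is a set of measurable functions $\Xi\to[0,1]$. For a function $f$, $P(f):=\mathbb{E}_{\xi\sim P}[f(\xi)]$, $P_n(f):=n^{-1}\sum_if(\xi_i)$, and $\operatorname{var}_P(f)$ is the variance of $f(\xi)$, $\xi\sim P$. When $f$ is data-dependent (such as $\widehat f_m$), $P(f)$ is the integral of $f$ with respect to $P$ with the data held fixed. It is assumed that a minimizer $f^{\star}$ of $P(f)$ over $\mathcal{F}$ exists. Each model satisfies $\mathcal{F}_m\subset\mathcal{F}$; $f_m\in\arg\min_{f\in\mathcal{F}_m}P(f)$ and $\widehat f_m\in\arg\min_{f\in\mathcal{F}_m}P_n(f)$; these minimizers, and $\widehat m$, are assumed to exist (measurability is tacitly assumed). $\operatorname{pen}:\mathcal{M}_n\to\mathbb{R}$ is a data-dependent function, called the penalty. *)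

theory Defs
  imports "HOL-Probability.Probability"
begin

definition iid_sample :: "'w measure \<Rightarrow> 'x measure \<Rightarrow> nat \<Rightarrow> (nat \<Rightarrow> 'w \<Rightarrow> 'x) \<Rightarrow> bool" where
  "iid_sample \<Omega> P n \<xi> \<longleftrightarrow>
     prob_space.indep_vars \<Omega> (\<lambda>_. P) \<xi> {1..n} \<and> (\<forall>i\<in>{1..n}. distr \<Omega> P (\<xi> i) = P)"

(* The integral of f with respect to the empirical measure of \<xi> 1 \<omega>, ..., \<xi> n \<omega>.
   In the definitions below, differences of functions are pointwise (fun_diff_def). *)
definition emp_mean :: "nat \<Rightarrow> (nat \<Rightarrow> 'w \<Rightarrow> 'x) \<Rightarrow> 'w \<Rightarrow> ('x \<Rightarrow> real) \<Rightarrow> real" where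
  "emp_mean n \<xi> \<omega> f = (1 / real n) * (\<Sum>i=1..n. f (\<xi> i \<omega>))"

definition dev_term ::
  "'x measure \<Rightarrow> nat \<Rightarrow> ('m \<Rightarrow> real) \<Rightarrow> ('m \<Rightarrow> 'x \<Rightarrow> real) \<Rightarrow> ('x \<Rightarrow> real) \<Rightarrow> 'm \<Rightarrow> real" where
  "dev_term P n t f fstar m = sqrt (2 * t m / real n * prob_space.variance P (f m - fstar))"

(* The supremum may be infinite, hence extended reals. The last argument is the
   penalty at a fixed outcome, so this quantity is random. *)
definition remainder_term ::
  "'x measure \<Rightarrow> nat \<Rightarrow> 'm set \<Rightarrow> ('m \<Rightarrow> real) \<Rightarrow> ('m \<Rightarrow> 'x \<Rightarrow> real) \<Rightarrow> ('x \<Rightarrow> real) \<Rightarrow>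
   real \<Rightarrow> real \<Rightarrow> ('m \<Rightarrow> real) \<Rightarrow> ereal" where
  "remainder_term P n I t f fstar c \<epsilon> p =
     ereal (1 / (1 - \<epsilon>)) *
     (SUP m\<in>I. ereal (dev_term P n t f fstar m - \<epsilon> * (\<integral>x. (f m - fstar) x \<partial>P) - c * p m))"

end

theory Submission
  imports Defs
begin

text \<open>
  On the given event and by the choice of \<open>mhat\<close>, the excess risk of the selected estimator is
  bounded, for every model m, by \<open>P (f m - fstar) + pen m + (P_n - P) (f m - fstar)\<close> plus
  \<open>(P - P_n) (f (mhat) - fstar) - c pen (mhat) - t (mhat) / n\<close>. Both deviations are controlled by
  Bernstein's inequality and a union bound. In the first one \<open>f m - fstar\<close> exceeds its nonnegative mean
  by at most 1, which gives the term \<open>t m / (3 n)\<close>. In the second one the centred variable is only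
  bounded by 2, and the resulting \<open>2 t / (3 n)\<close> is absorbed by \<open>- t / n\<close>.
\<close>

section \<open>An elementary exponential inequality\<close>

text \<open>The difference of the two sides is convex with a critical point and value 0 at the origin.\<close>
lemma exp_mult_le_quadratic:
  fixes y :: real
  shows "exp y * (6 - 2 * y) \<le> 6 + 4 * y + y\<^sup>2"
proof -
  define h where "h = (\<lambda>y::real. 6 + 4 * y + y\<^sup>2 - exp y * (6 - 2 * y))"
  define h' where "h' = (\<lambda>y::real. 4 + 2 * y - exp y * (4 - 2 * y))"
  have h: "(h has_real_derivative h' x) (at x)" for x
    unfolding h_def h'_def
    by (auto intro!: derivative_eq_intros simp: algebra_simps)
  have h': "(h' has_real_derivative 2 - exp x * (2 - 2 * x)) (at x)" for x
    unfolding h'_def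
    by (auto intro!: derivative_eq_intros simp: algebra_simps)
  \<comment> \<open>Despite the name, this concerns the derivative of \<open>h'\<close>, that is,
    the second derivative of \<open>h\<close>; it is nonnegative because \<open>exp (- x)\<close> is
    at least \<open>1 - x\<close>.\<close>
  have h'_nonneg: "2 - exp x * (2 - 2 * x) \<ge> 0" for x :: real
  proof -
    have "exp x * (1 - x) \<le> exp x * exp (- x)"
      using exp_ge_add_one_self[of "- x"] by (intro mult_left_mono) auto
    then show ?thesis by (simp add: exp_minus algebra_simps)
  qed
  have mono: "h' x \<le> h' y" if "x \<le> y" for x y
    using h' h'_nonneg by (intro DERIV_nonneg_imp_nondecreasing[OF that]) blast
  have "h 0 \<le> h y"
  proof (cases "y \<ge> 0")
    case True
    have "\<exists>z. (h has_real_derivative z) (at x) \<and> z \<ge> 0" if "0 \<le> x" for x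
      using h[of x] mono[OF that] by (auto simp: h'_def)
    then show ?thesis
      by (intro DERIV_nonneg_imp_nondecreasing[OF True]) blast
  next
    case False
    have "\<exists>z. (h has_real_derivative z) (at x) \<and> z \<le> 0" if "x \<le> 0" for x
      using h[of x] mono[OF that] by (auto simp: h'_def)
    with False show ?thesis
      by (intro DERIV_nonpos_imp_nonincreasing[of y 0]) auto
  qed
  then show ?thesis by (simp add: h_def)
qed

text \<open>The quadratic bound is divided by \<open>6 - 2 * y\<close>, which is positive since
  \<open>y\<close> is below 3. Replacing \<open>y\<close> by \<open>B\<close> in the denominator
  alone makes the coefficient of the square uniform in \<open>y\<close>, so that the bound can be
  integrated.\<close>

lemma exp_le_Bernstein:
  fixes y B :: real
  assumes "y \<le> B" "B < 3"
  shows "exp y \<le> 1 + y + y\<^sup>2 / (2 * (1 - B / 3))"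
proof -
  have "exp y \<le> (6 + 4 * y + y\<^sup>2) / (6 - 2 * y)"
    using exp_mult_le_quadratic[of y] assms by (simp add: field_simps)
  also have "\<dots> = 1 + y + y\<^sup>2 / (2 * (1 - y / 3))"
    using assms by (simp add: divide_simps power2_eq_square) (simp add: algebra_simps)
  also have "\<dots> \<le> 1 + y + y\<^sup>2 / (2 * (1 - B / 3))"
    using assms by (intro add_left_mono divide_left_mono mult_pos_pos) auto
  finally show ?thesis .
qed

section \<open>Bernstein's inequality and the union bound\<close>

context prob_space
begin

text \<open>Integrating the pointwise bound kills the linear term, since \<open>X\<close> is
  centred, and \<open>1 + u \<le> exp u\<close> restores an exponential. The bound on
  \<open>X\<close> is one-sided: large negative values are controlled by the second moment. The
  nonnegative integral is the form in which independence and the Chernoff bound are applied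
  below.\<close>

lemma nn_integral_exp_le_Bernstein:
  fixes X :: "'a \<Rightarrow> real"
  assumes [simp]: "integrable M X" "integrable M (\<lambda>x. (X x)\<^sup>2)"
    and "expectation X = 0" "AE x in M. X x \<le> b" "l \<ge> 0" "l * b < 3"
  shows "(\<integral>\<^sup>+x. ennreal (exp (l * X x)) \<partial>M)
           \<le> ennreal (exp (l\<^sup>2 * expectation (\<lambda>x. (X x)\<^sup>2) / (2 * (1 - l * b / 3))))"
proof -
  define K where "K = l\<^sup>2 / (2 * (1 - l * b / 3))"
  have bound: "AE x in M. exp (l * X x) \<le> 1 + l * X x + K * (X x)\<^sup>2"
    using assms(4)
  proof eventually_elim
    case (elim x)
    then have "l * X x \<le> l * b" using assms(5) by (rule mult_left_mono)
    from exp_le_Bernstein[OF this assms(6)] show ?case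
      by (simp add: K_def power_mult_distrib)
  qed
  have "(\<integral>\<^sup>+x. ennreal (exp (l * X x)) \<partial>M) \<le> (\<integral>\<^sup>+x. ennreal (1 + l * X x + K * (X x)\<^sup>2) \<partial>M)"
    using bound by (intro nn_integral_mono_AE) (auto intro: ennreal_leI)
  also have "\<dots> = ennreal (expectation (\<lambda>x. 1 + l * X x + K * (X x)\<^sup>2))"
  proof (intro nn_integral_eq_integral)
    show "AE x in M. 0 \<le> 1 + l * X x + K * (X x)\<^sup>2"
      using bound by eventually_elim (meson exp_ge_zero order_trans)
  qed simp
  also have "expectation (\<lambda>x. 1 + l * X x + K * (X x)\<^sup>2) = 1 + K * expectation (\<lambda>x. (X x)\<^sup>2)"
    using assms(3) by (simp add: prob_space)
  also have "\<dots> \<le> exp (K * expectation (\<lambda>x. (X x)\<^sup>2))"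
    by (rule exp_ge_add_one_self)
  finally show ?thesis by (simp add: K_def ennreal_leI)
qed

text \<open>Chernoff's method: independence multiplies the exponential moments, and the threshold is
  the one at which the infimum of the exponent over \<open>l\<close> equals
  \<open>- t\<close>.\<close>

lemma Bernstein_inequality:
  fixes X :: "'i \<Rightarrow> 'a \<Rightarrow> real"
  assumes J: "finite J" and indep: "indep_vars (\<lambda>_. borel) X J"
    and int: "\<And>i. i \<in> J \<Longrightarrow> integrable M (X i)" "\<And>i. i \<in> J \<Longrightarrow> integrable M (\<lambda>x. (X i x)\<^sup>2)"
    and centred: "\<And>i. i \<in> J \<Longrightarrow> expectation (X i) = 0"
    and bound: "\<And>i. i \<in> J \<Longrightarrow> AE x in M. X i x \<le> b"
    and "b > 0" "t > 0"
  defines "V \<equiv> (\<Sum>i\<in>J. expectation (\<lambda>x. (X i x)\<^sup>2))"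
  shows "prob {x \<in> space M. sqrt (2 * V * t) + b * t / 3 \<le> (\<Sum>i\<in>J. X i x)} \<le> exp (- t)"
proof -
  define s where "s = sqrt (2 * V * t) + b * t / 3"
  define p where "p = prob {x \<in> space M. s \<le> (\<Sum>i\<in>J. X i x)}"
  have [measurable]: "X i \<in> borel_measurable M" if "i \<in> J" for i
    using int(1)[OF that] by simp
  have chernoff: "p \<le> exp (- l * s + l\<^sup>2 * V / (2 * (1 - l * b / 3)))" if l: "l > 0" "l * b < 3" for l
  proof -
    have "(\<integral>\<^sup>+x. ennreal (exp (l * (\<Sum>i\<in>J. X i x))) * indicator (space M) x \<partial>M)
        = (\<integral>\<^sup>+x. (\<Prod>i\<in>J. ennreal (exp (l * X i x))) \<partial>M)"
      using J by (intro nn_integral_cong) (simp add: sum_distrib_left exp_sum prod_ennreal)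
    also have "\<dots> = (\<Prod>i\<in>J. \<integral>\<^sup>+x. ennreal (exp (l * X i x)) \<partial>M)"
      by (intro indep_vars_nn_integral J indep_vars_compose2[OF indep]) auto
    also have "\<dots> \<le> (\<Prod>i\<in>J. ennreal (exp (l\<^sup>2 * expectation (\<lambda>x. (X i x)\<^sup>2) / (2 * (1 - l * b / 3)))))"
      using l int centred bound
      by (intro prod_mono_ennreal nn_integral_exp_le_Bernstein) auto
    also have "\<dots> = ennreal (exp (l\<^sup>2 * V / (2 * (1 - l * b / 3))))"
      using J by (simp add: prod_ennreal exp_sum[symmetric] V_def sum_distrib_left sum_divide_distrib)
    finally have mgf: "(\<integral>\<^sup>+x. ennreal (exp (l * (\<Sum>i\<in>J. X i x))) * indicator (space M) x \<partial>M) \<le> \<dots>" .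
    have "emeasure M {x \<in> space M. s \<le> (\<Sum>i\<in>J. X i x)}
        \<le> ennreal (exp (- l * s)) * (\<integral>\<^sup>+x. ennreal (exp (l * (\<Sum>i\<in>J. X i x))) * indicator (space M) x \<partial>M)"
      by (rule Chernoff_ineq_nn_integral_ge) (use l in measurable)
    also have "\<dots> \<le> ennreal (exp (- l * s)) * ennreal (exp (l\<^sup>2 * V / (2 * (1 - l * b / 3))))"
      using mgf by (rule mult_left_mono) simp
    also have "\<dots> = ennreal (exp (- l * s + l\<^sup>2 * V / (2 * (1 - l * b / 3))))"
      by (simp only: ennreal_mult[symmetric] exp_ge_zero exp_add)
    finally show ?thesis
      unfolding p_def by (simp only: emeasure_eq_measure ennreal_le_iff exp_ge_zero)
  qed
  have "V \<ge> 0" unfolding V_def by (intro sum_nonneg) auto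
  have "p \<le> exp (- t)"
  proof (cases "V = 0")
    \<comment> \<open>The exponent is now linear in \<open>l\<close> and improves up to
      \<open>l = 3 / b\<close>, which the condition \<open>l * b < 3\<close> excludes; hence
      \<open>l = 3 * r / b\<close> and a limit as \<open>r\<close> tends to 1 from below.\<close>
    case True
    have "p \<le> exp (- (r * t))" if "0 < r" "r < 1" for r
      using chernoff[of "3 * r / b"] that \<open>b > 0\<close> by (simp add: s_def True)
    moreover have "((\<lambda>r. exp (- (r * t))) \<longlongrightarrow> exp (- (1 * t))) (at_left 1)"
      by (intro tendsto_intros)
    ultimately show ?thesis
      using eventually_at_left_real[of 0 "1::real"]
      by (intro tendsto_lowerbound[of _ "exp (- t)" "at_left 1"])
         (auto elim!: eventually_mono)
  next
    case False
    \<comment> \<open>The minimiser of the Chernoff exponent.\<close>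
    define a where "a = sqrt (2 * t / V)"
    define c where "c = b / 3"
    define l where "l = a / (1 + c * a)"
    have "V > 0" using False \<open>V \<ge> 0\<close> by simp
    then have "a > 0" and a2: "V * a\<^sup>2 = 2 * t" using \<open>t > 0\<close> by (auto simp: a_def)
    have "c > 0" using \<open>b > 0\<close> by (simp add: c_def)
    have d: "1 + c * a > 0" using \<open>a > 0\<close> \<open>c > 0\<close> by (simp add: add_pos_pos)
    have "sqrt (2 * V * t) = V * a"
    proof (rule real_sqrt_unique)
      show "(V * a)\<^sup>2 = 2 * V * t" using a2 by (simp add: power2_eq_square algebra_simps)
    qed (use \<open>a > 0\<close> \<open>V > 0\<close> in simp)
    then have s: "s = V * a + c * t" by (simp add: s_def c_def)
    have lc: "1 - l * b / 3 = 1 / (1 + c * a)"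
      using d by (simp add: l_def c_def field_simps)
    have "1 - l * b / 3 > 0" unfolding lc using d by simp
    then have "l * b < 3" by simp
    moreover have "l > 0" using \<open>a > 0\<close> d by (simp add: l_def)
    \<comment> \<open>By \<open>lc\<close>, dividing by \<open>1 - l * b / 3\<close> cancels one of
      the two factors \<open>1 / (1 + c * a)\<close> in \<open>l\<^sup>2\<close>; then
      \<open>V * a\<^sup>2 = 2 * t\<close> turns the numerator into
      \<open>- t * (1 + c * a)\<close>.\<close>
    moreover have "- l * s + l\<^sup>2 * V / (2 * (1 - l * b / 3)) = - t"
    proof -
      have "l\<^sup>2 * V / (2 * (1 - l * b / 3)) = (V * a\<^sup>2) / 2 / (1 + c * a)"
        unfolding lc using d by (simp add: l_def power2_eq_square) (simp add: algebra_simps)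
      also have "\<dots> = t / (1 + c * a)" using a2 by simp
      finally have "- l * s + l\<^sup>2 * V / (2 * (1 - l * b / 3)) = (t - (V * a\<^sup>2 + c * a * t)) / (1 + c * a)"
        by (simp add: l_def s power2_eq_square algebra_simps diff_divide_distrib add_divide_distrib)
      also have "\<dots> = - t"
        unfolding a2 using d by (simp add: field_simps)
      finally show ?thesis .
    qed
    ultimately show ?thesis using chernoff[of l] by simp
  qed
  then show ?thesis by (simp add: p_def s_def)
qed

text \<open>Finite subadditivity bounds every finite subunion by the total, and a bound uniform over
  finite subunions passes to the countable union. The sum lives in the extended reals, since over
  the reals a divergent one would get the default value 0.\<close>

lemma prob_UN_le_infsum:
  assumes "countable I" and X: "\<And>i. i \<in> I \<Longrightarrow> X i \<in> events"
    and q: "\<And>i. i \<in> I \<Longrightarrow> prob (X i) \<le> q i"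
  shows "ereal (prob (\<Union>i\<in>I. X i)) \<le> (\<Sum>\<^sub>\<infinity>i\<in>I. ereal (q i))"
proof -
  have q0: "q i \<ge> 0" if "i \<in> I" for i
    using q[OF that] measure_nonneg order_trans by blast
  have fin: "ereal (prob (\<Union>i\<in>J. X i)) \<le> (\<Sum>\<^sub>\<infinity>i\<in>I. ereal (q i))" if J: "J \<subseteq> I" "finite J" for J
  proof -
    have "prob (\<Union>i\<in>J. X i) \<le> (\<Sum>i\<in>J. prob (X i))"
      using J X by (intro finite_measure_subadditive_finite) auto
    also have "\<dots> \<le> (\<Sum>i\<in>J. q i)" using J q by (intro sum_mono) auto
    finally have "ereal (prob (\<Union>i\<in>J. X i)) \<le> (\<Sum>i\<in>J. ereal (q i))" by simp
    also have "\<dots> \<le> (\<Sum>\<^sub>\<infinity>i\<in>I. ereal (q i))"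
      using q0 J by (subst nonneg_infsum_complete) (auto intro!: SUP_upper)
    finally show ?thesis .
  qed
  show ?thesis
  proof (cases "\<Sum>\<^sub>\<infinity>i\<in>I. ereal (q i)")
    case (real r)
    have "prob (\<Union>i\<in>I. X i) \<le> r"
    proof (rule measure_UN_bound[OF assms(1)])
      show "X i \<in> fmeasurable M" if "i \<in> I" for i
        using X[OF that] by (simp add: fmeasurable_eq_sets)
      show "prob (\<Union>i\<in>J. X i) \<le> r" if "J \<subseteq> I" "finite J" for J
        using fin[OF that] by (simp add: real)
    qed
    then show ?thesis by (simp add: real)
  next
    \<comment> \<open>The empty subfamily already shows that the sum is nonnegative.\<close>
    case MInf
    then show ?thesis using fin[of "{}"] by simp
  qed simp
qed

end

section \<open>Deviations of the empirical mean\<close>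

text \<open>Bernstein's inequality for the centred variables \<open>h (\<xi> i \<omega>)\<close>,
  whose second moments add up to \<open>n\<close> times the variance of \<open>g\<close>, divided by
  \<open>n\<close>. The one-sided bound \<open>b\<close> on the centred function is kept apart from
  the bound 1 on the absolute value of \<open>g\<close>, because the two applications take
  \<open>b = 1\<close> and \<open>b = 2\<close>.\<close>

lemma Bernstein_emp_mean:
  assumes "prob_space M" "prob_space P" and n: "n \<ge> 1" and iid: "iid_sample M P n \<xi>"
    and g[measurable]: "g \<in> borel_measurable P" and g1: "\<And>x. x \<in> space P \<Longrightarrow> \<bar>g x\<bar> \<le> 1"
    and gb: "\<And>x. x \<in> space P \<Longrightarrow> g x - (\<integral>x. g x \<partial>P) \<le> b" and "b > 0" "t > 0"
  defines "s \<equiv> sqrt (2 * t / real n * prob_space.variance P g) + b * t / (3 * real n)"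
  shows "{\<omega> \<in> space M. s \<le> emp_mean n \<xi> \<omega> g - (\<integral>x. g x \<partial>P)} \<in> sets M" (is "?E \<in> _")
    and "measure M {\<omega> \<in> space M. s \<le> emp_mean n \<xi> \<omega> g - (\<integral>x. g x \<partial>P)} \<le> exp (- t)"
proof -
  interpret M: prob_space M by fact
  interpret P: prob_space P by fact
  have indep: "M.indep_vars (\<lambda>_. P) \<xi> {1..n}" and distr: "\<And>i. i \<in> {1..n} \<Longrightarrow> distr M P (\<xi> i) = P"
    using iid by (auto simp: iid_sample_def)
  have \<xi>[measurable]: "\<xi> i \<in> measurable M P" if "i \<in> {1..n}" for i
    using indep that by (auto simp: M.indep_vars_def)
  define h where "h = (\<lambda>x. g x - P.expectation g)"
  have [measurable]: "h \<in> borel_measurable P" by (simp add: h_def)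
  have int_g: "integrable P g" using g1 by (intro P.integrable_const_bound[of _ 1]) auto
  have int_g2: "integrable P (\<lambda>x. (g x)\<^sup>2)"
    using g1 by (intro P.integrable_const_bound[of _ 1]) (auto simp: abs_square_le_1)
  have int_h: "integrable P h" using int_g by (simp add: h_def)
  have int_h2: "integrable P (\<lambda>x. (h x)\<^sup>2)"
    using int_g int_g2 by (simp add: h_def power2_diff)
  have h0: "P.expectation h = 0" using int_g by (simp add: h_def P.prob_space)
  \<comment> \<open>Each \<open>\<xi> i\<close> has law \<open>P\<close>, so moments and
    integrability on the sample space reduce to those under \<open>P\<close>.\<close>
  have tr: "M.expectation (\<lambda>\<omega>. k (\<xi> i \<omega>)) = P.expectation k"
    if "i \<in> {1..n}" "k \<in> borel_measurable P" for i and k :: "_ \<Rightarrow> real"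
    using integral_distr[OF \<xi>[OF that(1)] that(2)] distr[OF that(1)] by simp
  have trI: "integrable M (\<lambda>\<omega>. k (\<xi> i \<omega>))"
    if "i \<in> {1..n}" "integrable P k" for i and k :: "_ \<Rightarrow> real"
    using integrable_distr[OF \<xi>[OF that(1)], of k] distr[OF that(1)] that(2) by simp
  have V: "(\<Sum>i\<in>{1..n}. M.expectation (\<lambda>\<omega>. (h (\<xi> i \<omega>))\<^sup>2)) = real n * P.variance g"
    by (subst sum.cong[OF refl tr]) (auto simp: h_def)
  have *: "M.prob {\<omega> \<in> space M. sqrt (2 * (real n * P.variance g) * t) + b * t / 3
      \<le> (\<Sum>i\<in>{1..n}. h (\<xi> i \<omega>))} \<le> exp (- t)"
    unfolding V[symmetric]
  proof (rule M.Bernstein_inequality)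
    show "M.indep_vars (\<lambda>_. borel) (\<lambda>i \<omega>. h (\<xi> i \<omega>)) {1..n}"
      by (rule M.indep_vars_compose2[OF indep]) simp
    show "AE \<omega> in M. h (\<xi> i \<omega>) \<le> b" if "i \<in> {1..n}" for i
      using gb measurable_space[OF \<xi>[OF that]] by (auto simp: h_def)
  qed (use assms int_h int_h2 in \<open>auto simp: tr h0 intro!: trI[of _ h] trI[of _ "\<lambda>x. (h x)\<^sup>2"]\<close>)
  have "sqrt (2 * (real n * P.variance g) * t) = real n * sqrt (2 * t / real n * P.variance g)"
  proof (rule real_sqrt_unique)
    have "0 \<le> 2 * t / real n * P.variance g" using \<open>t > 0\<close> by simp
    then have "(real n * sqrt (2 * t / real n * P.variance g))\<^sup>2
        = (real n)\<^sup>2 * (2 * t / real n * P.variance g)"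
      by (simp only: power_mult_distrib real_sqrt_pow2)
    then show "(real n * sqrt (2 * t / real n * P.variance g))\<^sup>2 = 2 * (real n * P.variance g) * t"
      using n by (simp add: power2_eq_square[of "real n"])
  qed (use \<open>t > 0\<close> in simp)
  then have s: "sqrt (2 * (real n * P.variance g) * t) + b * t / 3 = real n * s"
    using n by (simp add: s_def algebra_simps)
  have "(\<Sum>i\<in>{1..n}. h (\<xi> i \<omega>)) = real n * (emp_mean n \<xi> \<omega> g - P.expectation g)" for \<omega>
    using n by (simp add: h_def emp_mean_def sum_subtractf algebra_simps)
  then have "?E = {\<omega> \<in> space M. real n * s \<le> (\<Sum>i\<in>{1..n}. h (\<xi> i \<omega>))}"
    using n by simp
  with * s show "M.prob ?E \<le> exp (- t)" by simp
  show "?E \<in> sets M" unfolding emp_mean_def by measurable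
qed

section \<open>The oracle inequality for the selected estimator\<close>

theorem theorem3:
  fixes \<Omega> :: "'w measure" and P :: "'x measure"
    and n :: nat and \<xi> :: "nat \<Rightarrow> 'w \<Rightarrow> 'x"
    and F :: "('x \<Rightarrow> real) set" and fstar :: "'x \<Rightarrow> real"
    and I :: "'m set" and Fm :: "'m \<Rightarrow> ('x \<Rightarrow> real) set"
    and f :: "'m \<Rightarrow> 'x \<Rightarrow> real" and fhat :: "'m \<Rightarrow> 'w \<Rightarrow> 'x \<Rightarrow> real"
    and pen :: "'m \<Rightarrow> 'w \<Rightarrow> real" and mhat :: "'w \<Rightarrow> 'm"
    and t :: "'m \<Rightarrow> real" and c \<eta> :: real
  assumes "prob_space \<Omega>" and "prob_space P"
    and "n \<ge> 1" and "iid_sample \<Omega> P n \<xi>"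
    and "\<forall>g\<in>F. g \<in> borel_measurable P \<and> (\<forall>x\<in>space P. 0 \<le> g x \<and> g x \<le> 1)"
    and "is_arg_min (\<lambda>g. \<integral>x. g x \<partial>P) (\<lambda>g. g \<in> F) fstar"
    and "countable I"
    and "\<forall>m\<in>I. Fm m \<subseteq> F"
    and "\<forall>m\<in>I. is_arg_min (\<lambda>g. \<integral>x. g x \<partial>P) (\<lambda>g. g \<in> Fm m) (f m)"
    and "\<forall>\<omega>\<in>space \<Omega>. \<forall>m\<in>I. is_arg_min (emp_mean n \<xi> \<omega>) (\<lambda>g. g \<in> Fm m) (fhat m \<omega>)"
    and "\<forall>\<omega>\<in>space \<Omega>.
           is_arg_min (\<lambda>m. emp_mean n \<xi> \<omega> (fhat m \<omega>) + pen m \<omega>) (\<lambda>m. m \<in> I) (mhat \<omega>)"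
    and "\<forall>m\<in>I. t m > 0"
    and "0 < c" and "c < 1"
    and "\<exists>A\<in>sets \<Omega>. measure \<Omega> A \<ge> 1 - \<eta> \<and>
           (\<forall>\<omega>\<in>A. \<forall>m\<in>I.
              (1 - c) * pen m \<omega> \<ge>
                ((\<integral>x. (fhat m \<omega> - f m) x \<partial>P) - emp_mean n \<xi> \<omega> (fhat m \<omega> - f m)) + t m / real n \<and>
              ((\<integral>x. (fhat m \<omega> - f m) x \<partial>P) - emp_mean n \<xi> \<omega> (fhat m \<omega> - f m)) + t m / real n \<ge> 0)"
  shows "\<exists>B\<in>sets \<Omega>.
           ereal (measure \<Omega> B) \<ge> ereal (1 - \<eta>) - 2 * (\<Sum>\<^sub>\<infinity>m\<in>I. ereal (exp (- t m))) \<and>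
           (\<forall>\<omega>\<in>B. \<forall>\<epsilon>. 0 < \<epsilon> \<and> \<epsilon> < 1 \<longrightarrow>
              ereal (\<integral>x. (fhat (mhat \<omega>) \<omega> - fstar) x \<partial>P) \<le>
                ereal (1 / (1 - \<epsilon>)) *
                  (INF m\<in>I. ereal ((\<integral>x. (f m - fstar) x \<partial>P) + pen m \<omega>
                                     + dev_term P n t f fstar m + t m / (3 * real n)))
                + remainder_term P n I t f fstar c \<epsilon> (\<lambda>m. pen m \<omega>))"
proof -
  interpret M: prob_space \<Omega> by fact
  interpret P: prob_space P by fact
  note F = assms(5) and models = assms(8) and t_pos = assms(12)
  have fstar: "fstar \<in> F" and fstar_le: "\<And>g. g \<in> F \<Longrightarrow> P.expectation fstar \<le> P.expectation g"
    using assms(6) by (auto simp: is_arg_min_def not_less)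
  have f_mem: "f m \<in> Fm m" and f_F: "f m \<in> F"
    and f_le: "\<And>g. g \<in> Fm m \<Longrightarrow> P.expectation (f m) \<le> P.expectation g" if "m \<in> I" for m
    using assms(9) models that by (auto simp: is_arg_min_def not_less)
  have meas[measurable]: "g \<in> borel_measurable P" if "g \<in> F" for g
    using F that by auto
  have int: "integrable P g" if "g \<in> F" for g
    using F that by (intro P.integrable_const_bound[of _ 1]) auto
  have int_diff: "(\<integral>x. (g - h) x \<partial>P) = P.expectation g - P.expectation h" if "g \<in> F" "h \<in> F" for g h
    using that by (simp add: int)
  have emp_diff: "emp_mean n \<xi> \<omega> (g - h) = emp_mean n \<xi> \<omega> g - emp_mean n \<xi> \<omega> h" for \<omega> g h
    by (simp add: emp_mean_def sum_subtractf right_diff_distrib)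
  define v where "v = dev_term P n t f fstar"
  \<comment> \<open>\<open>U\<close> and \<open>L\<close> are the failure events of the two
    deviation bounds. The factor \<open>1 *\<close> keeps the literal form \<open>b * t\<close> of
    the deviation lemma, with \<open>b = 1\<close> here and \<open>b = 2\<close> in
    \<open>L\<close>.\<close>
  define U where "U = (\<lambda>m. {\<omega> \<in> space \<Omega>. v m + 1 * t m / (3 * real n)
      \<le> emp_mean n \<xi> \<omega> (f m - fstar) - P.expectation (f m - fstar)})"
  define L where "L = (\<lambda>m. {\<omega> \<in> space \<Omega>. v m + 2 * t m / (3 * real n)
      \<le> emp_mean n \<xi> \<omega> (fstar - f m) - P.expectation (fstar - f m)})"
  have U: "U m \<in> M.events" "M.prob (U m) \<le> exp (- t m)"
    and L: "L m \<in> M.events" "M.prob (L m) \<le> exp (- t m)" if m: "m \<in> I" for m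
  proof -
    \<comment> \<open>Minimality of \<open>fstar\<close> over all of \<open>F\<close> makes this
      mean nonnegative, so subtracting it preserves the bound 1. For the reversed difference the
      mean may be negative, but not below -1, hence the bound 2.\<close>
    have "P.expectation (f m - fstar) \<ge> 0"
      using fstar_le[OF f_F[OF m]] by (simp only: int_diff f_F m fstar)
    moreover have f01: "0 \<le> f m x" "f m x \<le> 1" "0 \<le> fstar x" "fstar x \<le> 1" if "x \<in> space P" for x
      using F f_F[OF m] fstar that by auto
    moreover have "P.expectation (fstar - f m) \<ge> - 1"
    proof -
      have "P.expectation (f m) \<le> P.expectation (\<lambda>_. 1)"
        using f01 int[OF f_F[OF m]] by (intro integral_mono) auto
      moreover have "0 \<le> P.expectation fstar"
        using f01 by (intro Bochner_Integration.integral_nonneg) auto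
      ultimately show ?thesis
        by (simp only: int_diff f_F m fstar) (simp add: P.prob_space)
    qed
    ultimately have bounds: "\<bar>(f m - fstar) x\<bar> \<le> 1" "\<bar>(fstar - f m) x\<bar> \<le> 1"
      "(f m - fstar) x - P.expectation (f m - fstar) \<le> 1"
      "(fstar - f m) x - P.expectation (fstar - f m) \<le> 2" if "x \<in> space P" for x
      using that by (smt (verit) minus_apply)+
    have diff_meas: "f m - fstar \<in> borel_measurable P" "fstar - f m \<in> borel_measurable P"
      using f_F[OF m] fstar by (auto simp: fun_diff_def)
    have "P.variance (fstar - f m) = P.variance (f m - fstar)"
      by (simp only: int_diff f_F m fstar) (simp add: power2_eq_square algebra_simps)
    then have v: "v m = sqrt (2 * t m / real n * P.variance (f m - fstar))"
      "v m = sqrt (2 * t m / real n * P.variance (fstar - f m))"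
      by (simp_all only: v_def dev_term_def)
    have tm: "t m > 0" using t_pos m by blast
    note B = Bernstein_emp_mean[OF \<open>prob_space \<Omega>\<close> \<open>prob_space P\<close> \<open>n \<ge> 1\<close> assms(4)]
    show "U m \<in> M.events" "M.prob (U m) \<le> exp (- t m)"
      unfolding U_def v(1) by (rule B; simp only: bounds diff_meas tm zero_less_one)+
    show "L m \<in> M.events" "M.prob (L m) \<le> exp (- t m)"
      unfolding L_def v(2) by (rule B; simp only: bounds diff_meas tm zero_less_numeral)+
  qed
  obtain A where A: "A \<in> M.events" "M.prob A \<ge> 1 - \<eta>"
    and penA: "\<And>\<omega> m. \<omega> \<in> A \<Longrightarrow> m \<in> I \<Longrightarrow> (1 - c) * pen m \<omega> \<ge>
      ((\<integral>x. (fhat m \<omega> - f m) x \<partial>P) - emp_mean n \<xi> \<omega> (fhat m \<omega> - f m)) + t m / real n"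
    using assms(15) by blast
  \<comment> \<open>Both deviation bounds are needed for all models at once: the upper one because
    the infimum ranges over \<open>I\<close>, the lower one because the selected index depends on
    the outcome. The two unions account for the factor 2.\<close>
  define UU where "UU = (\<Union>m\<in>I. U m)"
  define LL where "LL = (\<Union>m\<in>I. L m)"
  have ev: "UU \<in> M.events" "LL \<in> M.events"
    unfolding UU_def LL_def using U L \<open>countable I\<close> by (auto intro!: sets.countable_UN'')
  have probs: "ereal (M.prob UU) \<le> (\<Sum>\<^sub>\<infinity>m\<in>I. ereal (exp (- t m)))"
    "ereal (M.prob LL) \<le> (\<Sum>\<^sub>\<infinity>m\<in>I. ereal (exp (- t m)))"
    unfolding UU_def LL_def using U L \<open>countable I\<close> by (auto intro!: M.prob_UN_le_infsum)
  show ?thesis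
  \<comment> \<open>The chosen event does not involve \<epsilon>, so the bound holds on it for all
    \<epsilon> simultaneously.\<close>
  proof (intro bexI[of _ "A - (UU \<union> LL)"] conjI ballI allI impI)
    show "A - (UU \<union> LL) \<in> M.events" using A ev by auto
    have "M.prob A \<le> M.prob ((A - (UU \<union> LL)) \<union> (UU \<union> LL))"
      using A ev by (intro M.finite_measure_mono) auto
    also have "\<dots> \<le> M.prob (A - (UU \<union> LL)) + M.prob (UU \<union> LL)"
      using A ev by (intro measure_Un_le) auto
    also have "\<dots> \<le> M.prob (A - (UU \<union> LL)) + (M.prob UU + M.prob LL)"
      using ev by (intro add_left_mono measure_Un_le) auto
    finally have "1 - \<eta> \<le> M.prob (A - (UU \<union> LL)) + (M.prob UU + M.prob LL)"
      using A by simp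
    \<comment> \<open>If the sum is infinite, the left side is minus infinity and the claim is
      trivial; otherwise all terms are real.\<close>
    then show "ereal (1 - \<eta>) - 2 * (\<Sum>\<^sub>\<infinity>m\<in>I. ereal (exp (- t m))) \<le> ereal (M.prob (A - (UU \<union> LL)))"
      using probs by (cases "\<Sum>\<^sub>\<infinity>m\<in>I. ereal (exp (- t m))") auto
  next
    fix \<omega> and \<epsilon> :: real
    assume \<omega>: "\<omega> \<in> A - (UU \<union> LL)" and \<epsilon>: "0 < \<epsilon> \<and> \<epsilon> < 1"
    then have "\<omega> \<in> space \<Omega>" using A sets.sets_into_space by blast
    define k where "k = mhat \<omega>"
    have k: "k \<in> I"
      and k_le: "\<And>m. m \<in> I \<Longrightarrow>
        emp_mean n \<xi> \<omega> (fhat k \<omega>) + pen k \<omega> \<le> emp_mean n \<xi> \<omega> (fhat m \<omega>) + pen m \<omega>"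
      using assms(11) \<open>\<omega> \<in> space \<Omega>\<close> by (auto simp: is_arg_min_def not_less k_def)
    have fhat_mem: "fhat m \<omega> \<in> Fm m"
      and fhat_le: "\<And>g. g \<in> Fm m \<Longrightarrow> emp_mean n \<xi> \<omega> (fhat m \<omega>) \<le> emp_mean n \<xi> \<omega> g"
      if "m \<in> I" for m
      using assms(10) \<open>\<omega> \<in> space \<Omega>\<close> that by (auto simp: is_arg_min_def not_less)
    have fhat_F: "fhat k \<omega> \<in> F" using fhat_mem[OF k] models k by auto
    define r where "r = (\<lambda>m. P.expectation (f m - fstar))"
    define X where "X = (\<integral>x. (fhat k \<omega> - fstar) x \<partial>P)"
    define s where "s = v k - \<epsilon> * r k - c * pen k \<omega>"
    \<comment> \<open>As \<open>fhat k \<omega>\<close> lies in \<open>Fm k\<close>, its risk is at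
      least that of \<open>f k\<close>. This later trades \<open>\<epsilon> * r k\<close> for
      \<open>\<epsilon> * X\<close>, whence the factor \<open>1 / (1 - \<epsilon>)\<close>.\<close>
    have r_le_X: "r k \<le> X"
      using f_le[OF k fhat_mem[OF k]] by (simp only: r_def X_def int_diff f_F k fstar fhat_F)
    \<comment> \<open>The selection rule compares \<open>k\<close> with \<open>m\<close>, and
      empirical minimality replaces \<open>fhat m \<omega>\<close> by \<open>f m\<close>. At
      \<open>k\<close>, the error splits through \<open>f k\<close>: the penalty condition handles
      \<open>fhat k \<omega> - f k\<close>, its \<open>pen k \<omega>\<close> cancelling the one in
      the criterion and leaving \<open>- c * pen k \<omega>\<close>, and the complement of
      \<open>L k\<close> handles \<open>f k - fstar\<close>.\<close>
    have X_le: "X \<le> (r m + pen m \<omega> + v m + t m / (3 * real n)) + (v k - c * pen k \<omega>)" if m: "m \<in> I" for m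
    proof -
      have "emp_mean n \<xi> \<omega> (f m) - emp_mean n \<xi> \<omega> fstar - r m < v m + t m / (3 * real n)"
        using \<omega> m \<open>\<omega> \<in> space \<Omega>\<close> by (auto simp: UU_def U_def r_def emp_diff not_le)
      moreover have "emp_mean n \<xi> \<omega> fstar - emp_mean n \<xi> \<omega> (f k) - P.expectation (fstar - f k)
          < v k + 2 * t k / (3 * real n)"
        using \<omega> k \<open>\<omega> \<in> space \<Omega>\<close> by (auto simp: LL_def L_def emp_diff not_le)
      moreover have "P.expectation (fstar - f k) = P.expectation fstar - P.expectation (f k)"
        by (rule int_diff[OF fstar f_F[OF k]])
      moreover have "2 * t k / (3 * real n) \<le> t k / real n"
        using t_pos k \<open>n \<ge> 1\<close> by (simp add: field_simps)
      moreover have "P.expectation (fhat k \<omega>) - P.expectation (f k)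
          - (emp_mean n \<xi> \<omega> (fhat k \<omega>) - emp_mean n \<xi> \<omega> (f k)) + t k / real n \<le> pen k \<omega> - c * pen k \<omega>"
        using penA[of \<omega> k] \<omega> k unfolding int_diff[OF fhat_F f_F[OF k]]
        by (simp add: emp_diff left_diff_distrib)
      moreover have "X = P.expectation (fhat k \<omega>) - P.expectation fstar"
        unfolding X_def by (rule int_diff[OF fhat_F fstar])
      moreover note k_le[OF m] fhat_le[OF m f_mem[OF m]]
      ultimately show ?thesis by linarith
    qed
    \<comment> \<open>Once \<open>s\<close> is split off, the left side is a real number independent
      of \<open>m\<close>, so the infimum can be taken; \<open>s\<close> itself is one term of the
      supremum. Bounding the two summands separately avoids any subtraction of infinite
      values.\<close>
    have "ereal ((1 - \<epsilon>) * X - s) \<le> (INF m\<in>I. ereal (r m + pen m \<omega> + v m + t m / (3 * real n)))"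
    proof (intro INF_greatest)
      fix m assume "m \<in> I"
      moreover have "\<epsilon> * r k \<le> \<epsilon> * X" using r_le_X \<epsilon> by simp
      ultimately show "ereal ((1 - \<epsilon>) * X - s) \<le> ereal (r m + pen m \<omega> + v m + t m / (3 * real n))"
        using X_le[of m] by (simp add: s_def left_diff_distrib)
    qed
    moreover have "ereal s \<le> (SUP m\<in>I. ereal (v m - \<epsilon> * r m - c * pen m \<omega>))"
      unfolding s_def by (rule SUP_upper[OF k])
    ultimately have "ereal (1 / (1 - \<epsilon>)) * ereal ((1 - \<epsilon>) * X - s) + ereal (1 / (1 - \<epsilon>)) * ereal s
        \<le> ereal (1 / (1 - \<epsilon>)) * (INF m\<in>I. ereal (r m + pen m \<omega> + v m + t m / (3 * real n)))
          + ereal (1 / (1 - \<epsilon>)) * (SUP m\<in>I. ereal (v m - \<epsilon> * r m - c * pen m \<omega>))"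
      using \<epsilon> by (intro add_mono ereal_mult_left_mono) auto
    moreover have "ereal (1 / (1 - \<epsilon>)) * ereal ((1 - \<epsilon>) * X - s) + ereal (1 / (1 - \<epsilon>)) * ereal s = ereal X"
      using \<epsilon> by (simp flip: add_divide_distrib)
    ultimately show "ereal (\<integral>x. (fhat (mhat \<omega>) \<omega> - fstar) x \<partial>P) \<le>
                ereal (1 / (1 - \<epsilon>)) *
                  (INF m\<in>I. ereal ((\<integral>x. (f m - fstar) x \<partial>P) + pen m \<omega>
                                     + dev_term P n t f fstar m + t m / (3 * real n)))
                + remainder_term P n I t f fstar c \<epsilon> (\<lambda>m. pen m \<omega>)"
      unfolding remainder_term_def X_def r_def v_def k_def by (simp only:)
  qed
qed

end
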